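(* Let $\tau(x)=\sum_{n\ge1}n^{n-1}x^n/n!$ and, for $n\ge0$, let $t_n(y)$ be the coefficient of $x^n/n!$ in $(1-\tau(x))^{-y}=\exp(-y\log(1-\tau(x)))$, written $t_n(y)=\sum_{k=0}^nt_{n,k}y^k$. Then (i) for integers $1\le k\le n$, $t_{n,k}=\sum_{k\le j\le i\le n}s_1(j,k)\frac{n^{n-i}i!}{j!}\binom{i-1}{j-1}\binom{n-1}{i-1}$; (ii) $t_n(y)=B_n(yt_{1,1},\ldots,yt_{n,1})$, where for $r\ge1$, $t_{r,1}=\sum_{1\le j\le i\le r}(-1)^{j-1}\frac{r^{r-i}i!}{j}\binom{i-1}{j-1}\binom{r-1}{i-1}$.
   Context: $s_1(j,k)$ are the signed Stirling numbers of the first kind ($x(x-1)\cdots(x-j+1)=\sum_k s_1(j,k)x^k$). $B_n:=\sum_{k=0}^nB_{n,k}$ is the complete Bell (exponential) polynomial, where $B_{0,0}=1$, $B_{n,0}=0$ ($n\ge1$) and for $1\le k\le n$, $B_{n,k}=\sum\frac{n!}{\prod_ir_i!(i!)^{r_i}}\prod_iX_i^{r_i}$ over non-negative integers with $\sum r_i=k$, $\sum ir_i=n$. *)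

theory Defs
  imports "HOL-Computational_Algebra.Computational_Algebra"
begin

definition stirling1 :: "nat \<Rightarrow> nat \<Rightarrow> int" where
  "stirling1 j k = coeff (\<Prod>i<j. [:- int i, 1:]) k"

text \<open>Multivariate polynomials are represented by their evaluation at \<open>X\<^sub>i = X i\<close>.
  Any solution of \<open>\<Sum>\<^sub>i i r\<^sub>i = n\<close> has \<open>r\<^sub>i = 0\<close> for \<open>i > n\<close>, so the exponent sequences
  \<open>(r\<^sub>i)\<close> for \<open>i \<ge> 1\<close> are the functions \<open>r\<close> vanishing outside \<open>{1..n}\<close>.\<close>

definition bell_exponents :: "nat \<Rightarrow> nat \<Rightarrow> (nat \<Rightarrow> nat) set" where
  "bell_exponents n k =
     {r. (\<forall>i. i \<notin> {1..n} \<longrightarrow> r i = 0) \<and> (\<Sum>i=1..n. r i) = k \<and> (\<Sum>i=1..n. i * r i) = n}"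

definition partial_bell :: "nat \<Rightarrow> nat \<Rightarrow> (nat \<Rightarrow> 'a) \<Rightarrow> 'a::field_char_0" where
  "partial_bell n k X =
     (if k = 0 then (if n = 0 then 1 else 0)
      else \<Sum>r\<in>bell_exponents n k.
             fact n / (\<Prod>i=1..n. fact (r i) * fact i ^ r i) * (\<Prod>i=1..n. X i ^ r i))"

definition complete_bell :: "nat \<Rightarrow> (nat \<Rightarrow> 'a) \<Rightarrow> 'a::field_char_0" where
  "complete_bell n X = (\<Sum>k=0..n. partial_bell n k X)"

definition tree_fps :: "'a::field_char_0 fps" where
  "tree_fps = Abs_fps (\<lambda>n. if n = 0 then 0 else of_nat (n ^ (n - 1)) / fact n)"

text \<open>The embedding of power series over \<open>'a\<close> into power series over \<open>'a[y]\<close>.\<close>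

definition fps_lift_poly :: "'a::comm_semiring_1 fps \<Rightarrow> 'a poly fps" where
  "fps_lift_poly f = Abs_fps (\<lambda>n. [:fps_nth f n:])"

text \<open>\<open>(1 - \<tau>(x))\<^sup>-\<^sup>y = exp (- y log (1 - \<tau>(x)))\<close> as a power series in \<open>x\<close> over \<open>'a[y]\<close>.
  Note that \<open>fps_ln 1\<close> is the series of \<open>log (1 + x)\<close>, and that \<open>[:0, -1:]\<close> is \<open>-y\<close>.\<close>

definition tree_power :: "'a::field_char_0 poly fps" where
  "tree_power =
     fps_lift_poly (fps_exp 1) oo
       (fps_const [:0, -1:] * fps_lift_poly (fps_ln 1 oo (- tree_fps)))"

definition tree_poly :: "nat \<Rightarrow> 'a::field_char_0 poly" where
  "tree_poly n = smult (fact n) (fps_nth tree_power n)"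

definition tree_coeff :: "nat \<Rightarrow> nat \<Rightarrow> 'a::field_char_0" where
  "tree_coeff n k = coeff (tree_poly n) k"

text \<open>Specialising the indeterminate to a number \<open>y\<close> gives the expected scalar power series.\<close>

lemma poly_fps_nth_mult:
  "poly (fps_nth (f * g) n) y =
     fps_nth (Abs_fps (\<lambda>n. poly (fps_nth f n) y) * Abs_fps (\<lambda>n. poly (fps_nth g n) y)) n"
  for f g :: "'a::comm_semiring_1 poly fps"
  by (simp add: fps_mult_nth poly_sum)

lemma poly_fps_nth_power:
  "poly (fps_nth (f ^ m) n) y = fps_nth (Abs_fps (\<lambda>n. poly (fps_nth f n) y) ^ m) n"
  for f :: "'a::comm_semiring_1 poly fps"
proof (induction m arbitrary: n)
  case 0
  show ?case by simp
next
  case (Suc m)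
  then have "Abs_fps (\<lambda>n. poly (fps_nth (f ^ m) n) y) = Abs_fps (\<lambda>n. poly (fps_nth f n) y) ^ m"
    by (simp add: fps_eq_iff)
  then show ?case by (simp add: poly_fps_nth_mult)
qed

lemma poly_tree_poly:
  "poly (tree_poly n) y =
     fact n * fps_nth (fps_exp 1 oo (fps_const (- y) * (fps_ln 1 oo (- tree_fps)))) n"
proof -
  have "Abs_fps (\<lambda>n. poly (fps_nth (fps_const [:0, -1:] * fps_lift_poly f) n) y) = fps_const (- y) * f"
    for f :: "'a fps"
    by (simp add: fps_eq_iff fps_lift_poly_def)
  then show ?thesis
    by (simp add: tree_poly_def tree_power_def fps_compose_nth poly_sum poly_fps_nth_power)
       (simp add: fps_lift_poly_def)
qed

end

theory Submission
  imports Defs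
begin

text \<open>
  The series whose coefficients are those claimed for \<open>\<tau>\<^sup>i\<close> turns into \<open>x\<^sup>i\<close> when composed with
  \<open>x exp (-x)\<close>, because the higher coefficients of the composition are \<open>N\<close>-th finite differences
  of a polynomial of degree \<open>N - 1\<close>; cancelling \<open>x exp (-x)\<close> gives
  \<open>n! [x\<^sup>n] \<tau>\<^sup>i = i! n\<^bsup>n-i\<^esup> binomial(n-1, i-1)\<close>. In the binomial series of \<open>(1 - \<tau>)\<^bsup>-y\<^esup>\<close> the coefficient
  \<open>binomial(y+i-1, i)\<close> of \<open>\<tau>\<^sup>i\<close> is expanded by Vandermonde's identity into
  \<open>\<Sum>\<^sub>j binomial(y, j) binomial(i-1, j-1)\<close>, and the falling factorials of \<open>y\<close> into Stirling numbers.
  Part (ii) is the exponential formula for \<open>exp (y L)\<close> with \<open>L = -log (1 - \<tau>)\<close>, as \<open>t\<^sub>r\<^sub>,\<^sub>1 = r! [x\<^sup>r] L\<close>.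
\<close>

section \<open>Coefficients of the powers of the tree series\<close>

text \<open>Up to the factor m!, the sum is the coefficient of x^m in exp(ax) (exp(x) - 1)^N, a
  series divisible by x^N.\<close>

lemma alternating_binomial_sum_power_eq_0:
  fixes a :: "'a::field_char_0"
  assumes "m < N"
  shows "(\<Sum>k\<le>N. of_nat (N choose k) * (-1) ^ (N - k) * (a + of_nat k) ^ m) = 0"
proof -
  have "fps_exp a * (fps_exp 1 - 1) ^ N =
      (\<Sum>k\<le>N. fps_const (of_nat (N choose k) * (-1) ^ (N - k)) * fps_exp (a + of_nat k))"
  proof -
    have "(fps_exp 1 - 1 :: 'a fps) ^ N = (fps_exp 1 + (-1)) ^ N" by simp
    also have "\<dots> = (\<Sum>k\<le>N. of_nat (N choose k) * fps_exp 1 ^ k * (-1) ^ (N - k))"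
      by (rule binomial_ring)
    finally have eq: "(fps_exp 1 - 1 :: 'a fps) ^ N =
        (\<Sum>k\<le>N. of_nat (N choose k) * fps_exp 1 ^ k * (-1) ^ (N - k))" .
    have "fps_const (of_nat (N choose k) * (-1) ^ (N - k) :: 'a) =
        of_nat (N choose k) * (-1) ^ (N - k)" for k
      by (simp flip: fps_of_nat fps_const_power fps_const_neg fps_const_mult fps_const_1_eq_1)
    then show ?thesis
      unfolding eq by (simp add: sum_distrib_left fps_exp_power_mult fps_exp_add_mult ac_simps)
  qed
  moreover have "(fps_exp a * (fps_exp 1 - 1) ^ N) $ m = 0"
  proof -
    have "fps_nth ((fps_exp 1 - 1 :: 'a fps) ^ N) j = 0" if "j < N" for j
      using that startsby_zero_power_prefix[of "fps_exp 1 - 1 :: 'a fps" N] by auto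
    then show ?thesis using assms by (simp add: fps_mult_nth)
  qed
  ultimately have "(\<Sum>k\<le>N. of_nat (N choose k) * (-1) ^ (N - k) * (a + of_nat k) ^ m / fact m) = 0"
    by (simp add: fps_sum_nth)
  then show ?thesis by (simp flip: sum_divide_distrib)
qed

lemma X_exp_uminus_power_nth:
  "((fps_X * fps_exp (-1)) ^ n :: 'a::field_char_0 fps) $ m =
     (if m < n then 0 else (- of_nat n) ^ (m - n) / fact (m - n))"
  by (simp add: power_mult_distrib fps_exp_power_mult fps_X_power_mult_nth)

text \<open>The coefficients i n^(n-i-1) / (n-i)! are those Lagrange inversion predicts for the i-th
  power of tau. Dividing by n avoids the exponent n-i-1, which natural subtraction would truncate at
  n = i.\<close>

lemma tree_power_series_compose:
  assumes "i \<ge> 1"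
  shows "Abs_fps (\<lambda>n. if n < i then 0 else of_nat i * of_nat n ^ (n - i) / (of_nat n * fact (n - i)))
      oo (fps_X * fps_exp (-1)) = (fps_X ^ i :: 'a::field_char_0 fps)"  (is "?T oo ?A = _")
proof (rule fps_ext)
  fix m
  show "(?T oo ?A) $ m = (fps_X ^ i :: 'a fps) $ m"
  proof (cases "m \<le> i")
    case True
    have "(?T oo ?A) $ m = (\<Sum>n=0..m. if n = i then 1 else 0)"
      unfolding fps_compose_nth using True assms
      by (intro sum.cong refl) (auto simp: X_exp_uminus_power_nth)
    with True show ?thesis by simp
  next
    case False
    define N where "N = m - i"
    have m: "m = i + N" and N: "N > 0" using False by (auto simp: N_def)
    have "(?T oo ?A) $ m = (\<Sum>n=i..m. ?T $ n * (?A ^ n) $ m)"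
      unfolding fps_compose_nth by (rule sum.mono_neutral_right) auto
    also have "\<dots> = (\<Sum>k\<le>N. ?T $ (i + k) * (?A ^ (i + k)) $ m)"
      by (rule sum.reindex_bij_witness[of _ "\<lambda>k. i + k" "\<lambda>n. n - i"]) (auto simp: m)
    \<comment> \<open>With z = i + k, the factors z^k of \<open>?T\<close> and (-z)^(N-k) of
      \<open>?A ^ (i + k)\<close> combine to a signed z^N. The division by z lowers the degree to N
      - 1, just below the order of the difference.\<close>
    also have "\<dots> = (\<Sum>k\<le>N. of_nat i / fact N *
        (of_nat (N choose k) * (-1) ^ (N - k) * (of_nat i + of_nat k) ^ (N - 1)))"
    proof (rule sum.cong[OF refl])
      fix k assume "k \<in> {..N}"
      then have k: "k \<le> N" by simp
      define z :: 'a where "z = of_nat i + of_nat k"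
      have z: "z \<noteq> 0"
        unfolding z_def using assms by (metis of_nat_add of_nat_eq_0_iff add_is_0 not_one_le_zero)
      have "z ^ k * z ^ (N - k) = z * z ^ (N - 1)"
        using k N by (simp flip: power_add power_Suc)
      then have pow: "z ^ k * (- z) ^ (N - k) = z * (-1) ^ (N - k) * z ^ (N - 1)"
        by (subst power_minus) (metis mult.assoc mult.commute)
      have choose: "of_nat (N choose k) = (fact N / (fact k * fact (N - k)) :: 'a)"
        using k by (rule binomial_fact)
      have "?T $ (i + k) * (?A ^ (i + k)) $ m =
          of_nat i * (z ^ k * (- z) ^ (N - k)) / (z * fact k * fact (N - k))"
        using k by (simp add: X_exp_uminus_power_nth m z_def)
      also have "\<dots> = of_nat i / fact N * (of_nat (N choose k) * (-1) ^ (N - k) * z ^ (N - 1))"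
        unfolding pow choose using z by (simp add: field_simps)
      finally show "?T $ (i + k) * (?A ^ (i + k)) $ m = of_nat i / fact N *
          (of_nat (N choose k) * (-1) ^ (N - k) * (of_nat i + of_nat k) ^ (N - 1))"
        unfolding z_def .
    qed
    also have "\<dots> = 0"
      using alternating_binomial_sum_power_eq_0[of "N - 1" N "of_nat i :: 'a"] N
      unfolding sum_distrib_left[symmetric] by simp
    finally show ?thesis using False by simp
  qed
qed

text \<open>The case i = 1 of the previous lemma says that tau composed with \<open>A\<close> is x,
  so \<open>tree_fps ^ i\<close> and \<open>T i\<close> both become x^i after composition with
  \<open>A\<close>.\<close>

lemma tree_fps_power_nth:
  assumes "1 \<le> i" "i \<le> n"
  shows "(tree_fps ^ i) $ n * fact n =
    (of_nat n ^ (n - i) * fact i * of_nat ((n - 1) choose (i - 1)) :: 'a::field_char_0)"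
proof -
  define T :: "nat \<Rightarrow> 'a fps" where
    "T i = Abs_fps (\<lambda>n. if n < i then 0 else of_nat i * of_nat n ^ (n - i) / (of_nat n * fact (n - i)))" for i
  define A :: "'a fps" where "A = fps_X * fps_exp (-1)"
  have A: "A $ 0 = 0" "A $ 1 \<noteq> 0" by (simp_all add: A_def)
  have T1: "T 1 = tree_fps"
  proof (rule fps_ext)
    fix n show "T 1 $ n = tree_fps $ n"
      by (cases n) (simp_all add: T_def tree_fps_def)
  qed
  have comp: "T i oo A = fps_X ^ i" if "i \<ge> 1" for i
    using tree_power_series_compose[OF that] by (simp add: T_def A_def)
  have "tree_fps ^ i oo A = T i oo A"
    using comp[of 1] comp[OF assms(1)] by (simp add: T1[symmetric] fps_compose_power[OF A(1), symmetric])
  then have "(tree_fps ^ i oo A) oo fps_inv A = (T i oo A) oo fps_inv A" by simp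
  \<comment> \<open>\<open>A\<close> has zero constant term and nonzero linear term, hence a
    compositional inverse that cancels it on the right.\<close>
  moreover have "(f oo A) oo fps_inv A = f" for f
    using fps_inv_right[OF A] by (simp add: fps_compose_assoc[symmetric] A fps_inv_def)
  ultimately have "tree_fps ^ i = T i" by simp
  then have "(tree_fps ^ i) $ n * fact n = (of_nat i :: 'a) * of_nat n ^ (n - i) / (of_nat n * fact (n - i)) * fact n"
    using assms by (simp add: T_def)
  also have "\<dots> = of_nat n ^ (n - i) * fact i * (fact (n - 1) / (fact (i - 1) * fact ((n - 1) - (i - 1))))"
    using assms by (simp add: fact_reduce[of n] fact_reduce[of i] field_simps)
  also have "\<dots> = of_nat n ^ (n - i) * fact i * of_nat ((n - 1) choose (i - 1))"
    using assms by (subst binomial_fact) auto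
  finally show ?thesis .
qed

section \<open>Binomial expansion of the tree power\<close>

text \<open>For h = x, both sides solve (1 + x) F' = c F with F(0) = 1, which determines F; the
  general case follows by substituting h.\<close>

lemma fps_exp_compose_ln:
  fixes c :: "'a::field_char_0"
  assumes "h $ 0 = 0"
  shows "fps_exp 1 oo (fps_const c * (fps_ln 1 oo h)) = fps_binomial c oo h"
proof -
  let ?E = "fps_exp 1 oo (fps_const c * fps_ln (1::'a))"
  have "fps_deriv ?E = fps_const c * ?E / (1 + fps_X)"
    by (simp add: fps_compose_deriv fps_ln_deriv fps_divide_unit ac_simps)
  moreover have "?E $ 0 = 1" by simp
  ultimately have E: "?E = fps_binomial c" using fps_binomial_ODE_unique' by blast
  have "fps_const c * (fps_ln 1 oo h) = (fps_const c * fps_ln 1) oo h"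
    using assms by (simp add: fps_compose_mult_distrib)
  then show ?thesis using assms by (simp add: fps_compose_assoc flip: E)
qed

text \<open>The sign from negating the upper index of binomial(-y, i) cancels the sign of
  (-tau)^i.\<close>

lemma poly_tree_poly_gbinomial:
  fixes y :: "'a::field_char_0"
  shows "poly (tree_poly n) y = (\<Sum>i=0..n. ((y + of_nat i - 1) gchoose i) * ((tree_fps ^ i) $ n * fact n))"
proof -
  have t: "(- tree_fps :: 'a fps) $ 0 = 0" by (simp add: tree_fps_def)
  have "(- y gchoose i) * ((- tree_fps) ^ i) $ n = ((y + of_nat i - 1) gchoose i) * (tree_fps ^ i) $ n" for i
  proof -
    have "(- y gchoose i) = (-1) ^ i * ((y + of_nat i - 1) gchoose i)"
      by (subst gbinomial_negated_upper) (simp add: algebra_simps)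
    moreover have "((- tree_fps :: 'a fps) ^ i) $ n = (-1) ^ i * (tree_fps ^ i) $ n"
    proof -
      have "(- tree_fps :: 'a fps) ^ i = fps_const ((-1) ^ i) * tree_fps ^ i"
        by (subst power_minus) (simp flip: fps_const_power fps_const_neg)
      then show ?thesis by simp
    qed
    ultimately show ?thesis by (simp flip: power_add add: mult_ac)
  qed
  then show ?thesis
    unfolding poly_tree_poly fps_exp_compose_ln[OF t] fps_compose_nth fps_binomial_nth
    by (simp add: sum_distrib_left mult_ac)
qed

text \<open>Vandermonde's identity for y + (i - 1). It rewrites rising factorials of y through
  falling ones, whose coefficients are the Stirling numbers.\<close>

lemma gbinomial_add_nat_minus_1:
  fixes y :: "'a::field_char_0"
  assumes "i \<ge> 1"
  shows "(y + of_nat i - 1) gchoose i = (\<Sum>j=1..i. (y gchoose j) * of_nat ((i - 1) choose (j - 1)))"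
proof -
  have "(y + of_nat i - 1) gchoose i = (y + of_nat (i - 1)) gchoose i"
    using assms by (simp add: of_nat_diff algebra_simps)
  also have "\<dots> = (\<Sum>j=0..i. (y gchoose j) * (of_nat (i - 1) gchoose (i - j)))"
    by (rule gbinomial_Vandermonde[symmetric])
  also have "\<dots> = (\<Sum>j=1..i. (y gchoose j) * (of_nat (i - 1) gchoose (i - j)))"
  \<comment> \<open>The term j = 0 carries binomial(i-1, i), which vanishes because i >= 1.\<close>
  proof (rule sum.mono_neutral_right, goal_cases)
    case 3
    have "of_nat (i - 1) gchoose i = (0 :: 'a)"
      using assms by (simp flip: binomial_gbinomial del: of_nat_diff)
    moreover have "{0..i} - {1..i} = {0}" by auto
    ultimately show ?case by simp
  qed auto
  also have "\<dots> = (\<Sum>j=1..i. (y gchoose j) * of_nat ((i - 1) choose (j - 1)))"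
  proof (rule sum.cong[OF refl])
    fix j assume "j \<in> {1..i}"
    then have "(i - 1) choose (i - j) = (i - 1) choose (j - 1)"
      by (subst binomial_symmetric) auto
    then show "(y gchoose j) * (of_nat (i - 1) gchoose (i - j)) =
        (y gchoose j) * of_nat ((i - 1) choose (j - 1))"
      by (simp flip: binomial_gbinomial)
  qed
  finally show ?thesis .
qed

section \<open>Stirling numbers and the coefficient formula (i)\<close>

lemma stirling1_0: "stirling1 0 k = (if k = 0 then 1 else 0)"
  by (simp add: stirling1_def)

lemma stirling1_Suc:
  "stirling1 (Suc j) k = (if k = 0 then 0 else stirling1 j (k - 1)) - int j * stirling1 j k"
  by (cases k) (simp_all add: stirling1_def mult.commute[of _ "[:_, 1:]"])

lemma stirling1_eq_0: "j < k \<Longrightarrow> stirling1 j k = 0"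
  by (induction j arbitrary: k) (auto simp: stirling1_0 stirling1_Suc)

text \<open>After removing the factor x from x(x-1)...(x-j), the constant term is the product of -1,
  ..., -j.\<close>

lemma stirling1_1: "stirling1 (Suc j) 1 = (-1) ^ j * fact j"
proof (induction j)
  case 0
  show ?case by (simp add: stirling1_Suc stirling1_0)
next
  case (Suc j)
  have "stirling1 (Suc j) 0 = 0" by (induction j) (simp_all add: stirling1_Suc stirling1_0)
  with Suc show ?case by (subst stirling1_Suc) (simp add: algebra_simps)
qed

lemma coeff_falling_factorial_poly:
  "coeff (\<Prod>i<j. [:- of_nat i, 1:] :: 'a::field_char_0 poly) k = of_int (stirling1 j k)"
proof (induction j arbitrary: k)
  case 0
  show ?case by (simp add: stirling1_0)
next
  case (Suc j)
  then show ?case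
    by (cases k) (simp_all add: stirling1_Suc mult.commute[of _ "[:_, 1:]"])
qed

lemma poly_falling_factorial:
  "poly (\<Prod>i<j. [:- of_nat i, 1:]) (y::'a::field_char_0) = fact j * (y gchoose j)"
  by (simp add: gbinomial_prod_rev poly_prod atLeast0LessThan)

text \<open>The expansion in falling factorials holds at every y, hence as an identity of
  polynomials whose coefficients can be compared.\<close>

lemma tree_coeff_stirling1:
  assumes "1 \<le> k" "k \<le> n"
  shows "(tree_coeff n k :: 'a::field_char_0) =
    (\<Sum>i=k..n. \<Sum>j=k..i.
       of_int (stirling1 j k) * (of_nat n ^ (n - i) * fact i / fact j)
       * of_nat ((i - 1) choose (j - 1)) * of_nat ((n - 1) choose (i - 1)))"
proof -
  define a :: "nat \<Rightarrow> nat \<Rightarrow> 'a" where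
    "a i j = of_nat n ^ (n - i) * fact i / fact j
       * of_nat ((i - 1) choose (j - 1)) * of_nat ((n - 1) choose (i - 1))" for i j
  have "tree_poly n = (\<Sum>i=1..n. \<Sum>j=1..i. smult (a i j) (\<Prod>l<j. [:- of_nat l, 1:]))"
  proof (rule poly_ext)
    fix y :: 'a
    have "poly (tree_poly n) y =
        (\<Sum>i=1..n. ((y + of_nat i - 1) gchoose i) * ((tree_fps ^ i) $ n * fact n))"
      \<comment> \<open>The summand i = 0 vanishes since n >= 1.\<close>
      using assms by (simp add: poly_tree_poly_gbinomial sum.atLeast_Suc_atMost)
    also have "\<dots> = (\<Sum>i=1..n. \<Sum>j=1..i. a i j * (fact j * (y gchoose j)))"
    proof (rule sum.cong[OF refl])
      fix i assume "i \<in> {1..n}"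
      then have i: "1 \<le> i" "i \<le> n" by auto
      show "((y + of_nat i - 1) gchoose i) * ((tree_fps ^ i) $ n * fact n) =
          (\<Sum>j=1..i. a i j * (fact j * (y gchoose j)))"
        unfolding tree_fps_power_nth[OF i] gbinomial_add_nat_minus_1[OF i(1)]
        by (simp add: sum_distrib_left a_def mult_ac)
    qed
    finally show "poly (tree_poly n) y =
        poly (\<Sum>i=1..n. \<Sum>j=1..i. smult (a i j) (\<Prod>l<j. [:- of_nat l, 1:])) y"
      by (simp add: poly_sum poly_falling_factorial)
  qed
  then have "tree_coeff n k = (\<Sum>i=1..n. \<Sum>j=1..i. a i j * of_int (stirling1 j k))"
    by (simp add: tree_coeff_def coeff_sum coeff_falling_factorial_poly)
  \<comment> \<open>Terms with j < k vanish with the Stirling number; afterwards the inner sum is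
    empty for i < k.\<close>
  also have "\<dots> = (\<Sum>i=1..n. \<Sum>j=k..i. a i j * of_int (stirling1 j k))"
    using assms by (intro sum.cong refl sum.mono_neutral_right) (auto simp: stirling1_eq_0)
  also have "\<dots> = (\<Sum>i=k..n. \<Sum>j=k..i. a i j * of_int (stirling1 j k))"
    using assms by (intro sum.mono_neutral_right) auto
  finally show ?thesis by (simp add: a_def mult_ac)
qed

lemma tree_coeff_1:
  assumes "1 \<le> r"
  shows "(tree_coeff r 1 :: 'a::field_char_0) =
    (\<Sum>i=1..r. \<Sum>j=1..i.
       (-1) ^ (j - 1) * (of_nat r ^ (r - i) * fact i / of_nat j)
       * of_nat ((i - 1) choose (j - 1)) * of_nat ((r - 1) choose (i - 1)))"
proof -
  have "of_int (stirling1 j 1) * (x / fact j) = (-1) ^ (j - 1) * (x / of_nat j)"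
    if "1 \<le> j" for j and x :: 'a
    using that stirling1_1[of "j - 1"] by (simp add: fact_reduce[of j])
  then show ?thesis
    unfolding tree_coeff_stirling1[OF order_refl assms] by (intro sum.cong refl) simp
qed

section \<open>Partial Bell polynomials as coefficients of powers\<close>

text \<open>Allows a series to be replaced by its truncation at degree n when the n-th coefficient
  of a power is sought.\<close>

lemma fps_power_nth_cong:
  fixes f g :: "'a::comm_semiring_1 fps"
  assumes "\<And>i. i \<le> n \<Longrightarrow> f $ i = g $ i" "i \<le> n"
  shows "(f ^ k) $ i = (g ^ k) $ i"
  using assms(2) by (induction k arbitrary: i) (auto simp: fps_mult_nth assms(1) intro!: sum.cong)

text \<open>The multinomial theorem, by induction on the number m of summands: the binomial theorem
  splits off the last summand, and its exponent l becomes the value of r at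
  \<open>Suc m\<close>.\<close>

lemma fps_multinomial_nth:
  fixes c :: "nat \<Rightarrow> 'a::field_char_0"
  shows "((\<Sum>i=1..m. fps_const (c i) * fps_X ^ i) ^ k) $ n =
    fact k * (\<Sum>r | (\<forall>i. i \<notin> {1..m} \<longrightarrow> r i = 0) \<and> (\<Sum>i=1..m. r i) = k \<and> (\<Sum>i=1..m. i * r i) = n.
      \<Prod>i=1..m. c i ^ r i / fact (r i))"
proof (induction m arbitrary: k n)
  case 0
  have *: "{r :: nat \<Rightarrow> nat. \<forall>i. r i = 0} = {\<lambda>_. 0}" by auto
  show ?case
    by (cases "k = 0"; cases "n = 0") (auto simp: * zero_power)
next
  case (Suc m)
  define E where "E m k n = {r. (\<forall>i. i \<notin> {1..m} \<longrightarrow> r i = (0::nat)) \<and> (\<Sum>i=1..m. r i) = k \<and> (\<Sum>i=1..m. i * r i) = n}"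
    for m k n :: nat
  define P where "P m r = (\<Prod>i=1..m. c i ^ r i / fact (r i))" for m and r :: "nat \<Rightarrow> nat"
  define F where "F m = (\<Sum>i=1..m. fps_const (c i) * fps_X ^ i)" for m
  have finE: "finite (E m k n)" for k n
  proof (rule finite_subset)
    show "E m k n \<subseteq> {r. \<forall>i. (i \<in> {1..m} \<longrightarrow> r i \<in> {..k}) \<and> (i \<notin> {1..m} \<longrightarrow> r i = 0)}"
      unfolding E_def by (auto intro!: member_le_sum)
    show "finite {r. \<forall>i. (i \<in> {1..m} \<longrightarrow> r i \<in> {..k}) \<and> (i \<notin> {1..m} \<longrightarrow> r i = (0::nat))}"
      by (rule finite_set_of_finite_funs) auto
  qed
  have IH: "(F m ^ k) $ n = fact k * (\<Sum>r\<in>E m k n. P m r)" for k n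
    using Suc by (simp add: E_def P_def F_def)
  let ?M = "Suc m"
  let ?L = "{l. l \<le> k \<and> ?M * l \<le> n}"
  have "F ?M ^ k = (fps_const (c ?M) * fps_X ^ ?M + F m) ^ k"
    by (simp add: F_def add.commute)
  also have "\<dots> = (\<Sum>l\<le>k. of_nat (k choose l) * (fps_const (c ?M) * fps_X ^ ?M) ^ l * F m ^ (k - l))"
    by (rule binomial_ring)
  also have "\<dots> = (\<Sum>l\<le>k. fps_const (of_nat (k choose l) * c ?M ^ l) * (fps_X ^ (?M * l) * F m ^ (k - l)))"
    unfolding power_mult
    by (simp only: power_mult_distrib fps_of_nat[symmetric] mult_ac
        fps_const_mult[symmetric] fps_const_power[symmetric])
  finally have "(F ?M ^ k) $ n =
      (\<Sum>l\<le>k. of_nat (k choose l) * c ?M ^ l * (if n < ?M * l then 0 else (F m ^ (k - l)) $ (n - ?M * l)))"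
    by (simp add: fps_sum_nth fps_X_power_mult_nth del: mult_Suc)
  \<comment> \<open>On \<open>?L\<close> the natural subtractions k - l and n - \<open>?M\<close> *
    l are exact.\<close>
  also have "\<dots> = (\<Sum>l\<in>?L. of_nat (k choose l) * c ?M ^ l * (F m ^ (k - l)) $ (n - ?M * l))"
    by (rule sum.mono_neutral_cong_right) auto
  also have "\<dots> = (\<Sum>l\<in>?L. \<Sum>r\<in>E m (k - l) (n - ?M * l). fact k * (P m r * (c ?M ^ l / fact l)))"
  proof (rule sum.cong[OF refl])
    fix l assume "l \<in> ?L"
    then have "of_nat (k choose l) = (fact k / (fact l * fact (k - l)) :: 'a)"
      by (intro binomial_fact) simp
    then have choose: "of_nat (k choose l) * fact (k - l) = (fact k / fact l :: 'a)"
      by simp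
    show "of_nat (k choose l) * c ?M ^ l * (F m ^ (k - l)) $ (n - ?M * l) =
        (\<Sum>r\<in>E m (k - l) (n - ?M * l). fact k * (P m r * (c ?M ^ l / fact l)))"
      unfolding IH sum_distrib_left
    proof (rule sum.cong[OF refl])
      fix r
      have "of_nat (k choose l) * c ?M ^ l * (fact (k - l) * P m r) =
          (of_nat (k choose l) * fact (k - l)) * (c ?M ^ l * P m r)"
        by (simp only: mult_ac)
      then show "of_nat (k choose l) * c ?M ^ l * (fact (k - l) * P m r) =
          fact k * (P m r * (c ?M ^ l / fact l))"
        unfolding choose by simp
    qed
  qed
  also have "\<dots> = (\<Sum>(l, r)\<in>(SIGMA l:?L. E m (k - l) (n - ?M * l)). fact k * (P m r * (c ?M ^ l / fact l)))"
    by (rule sum.Sigma) (auto simp: finE)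
  also have "\<dots> = (\<Sum>r\<in>E ?M k n. fact k * P ?M r)"
  \<comment> \<open>The pair (l, r) corresponds to r with l stored at \<open>?M\<close>, where r was
    0; the inverse reads that entry and clears it.\<close>
  proof (rule sum.reindex_bij_witness[of _ "\<lambda>r. (r ?M, r(?M := 0))" "\<lambda>(l, r). r(?M := l)"])
    have upd: "(\<Sum>i=1..m. (r(?M := l)) i) = (\<Sum>i=1..m. r i)"
      "(\<Sum>i=1..m. i * (r(?M := l)) i) = (\<Sum>i=1..m. i * r i)"
      "P m (r(?M := l)) = P m r" for r :: "nat \<Rightarrow> nat" and l
      unfolding P_def by (intro sum.cong prod.cong; simp)+
    have PM: "P ?M r = P m r * (c ?M ^ r ?M / fact (r ?M))" for r
      by (simp add: P_def)
    fix a assume a: "a \<in> (SIGMA l:?L. E m (k - l) (n - ?M * l))"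
    obtain l r where lr: "a = (l, r)" by (cases a)
    with a have l: "l \<le> k" "?M * l \<le> n" and r: "\<And>i. i \<notin> {1..m} \<Longrightarrow> r i = 0"
      "(\<Sum>i=1..m. r i) = k - l" "(\<Sum>i=1..m. i * r i) = n - ?M * l"
      by (auto simp: E_def simp del: mult_Suc)
    show "(case a of (l, r) \<Rightarrow> r(?M := l)) \<in> E ?M k n"
    proof -
      have "(\<Sum>i=1..?M. (r(?M := l)) i) = k" "(\<Sum>i=1..?M. i * (r(?M := l)) i) = n"
        using l r upd[of r l] by (simp_all del: fun_upd_apply mult_Suc) (simp_all del: mult_Suc)
      then show ?thesis using r(1) by (auto simp: lr E_def)
    qed
    show "((case a of (l, r) \<Rightarrow> r(?M := l)) ?M, (case a of (l, r) \<Rightarrow> r(?M := l))(?M := 0)) = a"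
      using r(1) by (auto simp: lr fun_eq_iff)
    show "fact k * P ?M (case a of (l, r) \<Rightarrow> r(?M := l)) =
        (case a of (l, r) \<Rightarrow> fact k * (P m r * (c ?M ^ l / fact l)))"
      by (simp add: lr PM upd)
  next
    fix r assume "r \<in> E ?M k n"
    then have r: "\<And>i. i \<notin> {1..?M} \<Longrightarrow> r i = 0"
      "(\<Sum>i=1..m. r i) + r ?M = k" "(\<Sum>i=1..m. i * r i) + ?M * r ?M = n"
      by (auto simp: E_def)
    have upd: "(\<Sum>i=1..m. (r(?M := 0)) i) = (\<Sum>i=1..m. r i)"
      "(\<Sum>i=1..m. i * (r(?M := 0)) i) = (\<Sum>i=1..m. i * r i)"
      by (intro sum.cong; simp)+
    have "r(?M := 0) \<in> E m (k - r ?M) (n - ?M * r ?M)"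
      unfolding E_def mem_Collect_eq upd using r by auto
    moreover have "r ?M \<in> ?L" using r by auto
    ultimately show "(r ?M, r(?M := 0)) \<in> (SIGMA l:?L. E m (k - l) (n - ?M * l))" by blast
    show "(case (r ?M, r(?M := 0)) of (l, r) \<Rightarrow> r(?M := l)) = r" by simp
  qed
  finally show ?case by (simp add: E_def P_def F_def sum_distrib_left)
qed

text \<open>Only the coefficients of f up to degree n matter, so f can be truncated and the
  multinomial theorem applied.\<close>

lemma partial_bell_fps_power:
  fixes X :: "nat \<Rightarrow> 'a::field_char_0"
  assumes "f $ 0 = 0" "\<And>i. i \<ge> 1 \<Longrightarrow> f $ i = X i / fact i"
  shows "partial_bell n k X = fact n * (f ^ k) $ n / fact k"
proof (cases "k = 0")
  case True
  then show ?thesis by (simp add: partial_bell_def)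
next
  case False
  have "(f ^ k) $ n = ((\<Sum>i=1..n. fps_const (X i / fact i) * fps_X ^ i) ^ k) $ n"
  proof (rule fps_power_nth_cong[OF _ order_refl])
    fix i assume "i \<le> n"
    have "(\<Sum>j=1..n. fps_const (X j / fact j) * fps_X ^ j) $ i = (\<Sum>j=1..n. if j = i then X j / fact j else 0)"
      unfolding fps_sum_nth by (intro sum.cong) auto
    with \<open>i \<le> n\<close> assms show "f $ i = (\<Sum>j=1..n. fps_const (X j / fact j) * fps_X ^ j) $ i"
      by (cases "i = 0") auto
  qed
  also have "\<dots> = fact k * (\<Sum>r\<in>bell_exponents n k. \<Prod>i=1..n. (X i / fact i) ^ r i / fact (r i))"
    unfolding fps_multinomial_nth bell_exponents_def ..
  finally show ?thesis
    using False
    by (simp add: partial_bell_def sum_distrib_left sum_divide_distrib power_divide prod_dividef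
        prod.distrib mult_ac)
qed

section \<open>The exponential formula (ii)\<close>

text \<open>With L = -log(1 - tau), this expands exp(yL) in powers of y instead of binomials; L has
  no constant term, so only k <= n contribute.\<close>

lemma tree_poly_eq_sum:
  "tree_poly n = (\<Sum>k=0..n. monom (fact n * ((- (fps_ln 1 oo (- tree_fps))) ^ k) $ n / fact k) k :: 'a::field_char_0 poly)"
proof (rule poly_ext)
  fix y :: 'a
  let ?L = "fps_ln 1 oo (- tree_fps) :: 'a fps"
  have "fps_const (- y) * ?L = fps_const y * (- ?L)"
    by (simp flip: fps_const_neg)
  then have "poly (tree_poly n) y = fact n * fps_nth (fps_exp 1 oo (fps_const y * (- ?L))) n"
    by (simp only: poly_tree_poly)
  then show "poly (tree_poly n) y = poly (\<Sum>k=0..n. monom (fact n * ((- ?L) ^ k) $ n / fact k) k) y"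
    by (simp add: fps_compose_nth power_mult_distrib poly_sum poly_monom
        sum_distrib_left mult_ac del: mult_minus_right)
qed

lemma tree_coeff_eq:
  "tree_coeff n k =
    (if k \<le> n then fact n * ((- (fps_ln 1 oo (- tree_fps))) ^ k) $ n / fact k else 0 :: 'a::field_char_0)"
  by (simp add: tree_coeff_def tree_poly_eq_sum coeff_sum)

lemma poly_tree_poly_eq_sum:
  "poly (tree_poly n) (y::'a::field_char_0) = (\<Sum>k=0..n. tree_coeff n k * y ^ k)"
  by (subst tree_poly_eq_sum) (simp add: poly_sum poly_monom tree_coeff_eq)

text \<open>The series yL has the numbers y t_{r,1} as exponential coefficients, so the k-th partial
  Bell polynomial takes the value t_{n,k} y^k.\<close>

lemma poly_tree_poly_complete_bell:
  "poly (tree_poly n) (y::'a::field_char_0) = complete_bell n (\<lambda>r. y * tree_coeff r 1)"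
proof -
  let ?f = "fps_const y * (- (fps_ln 1 oo (- tree_fps))) :: 'a fps"
  have "partial_bell n k (\<lambda>r. y * tree_coeff r 1) = fact n * (?f ^ k) $ n / fact k" for k
    by (rule partial_bell_fps_power) (simp_all add: tree_coeff_eq)
  then show ?thesis
    unfolding poly_tree_poly_eq_sum complete_bell_def
    by (intro sum.cong refl)
      (simp add: tree_coeff_eq[of n] power_mult_distrib mult_ac del: mult_minus_right)
qed


theorem theorem6p4:
  shows "(\<forall>n (y::'a::field_char_0). poly (tree_poly n) y = (\<Sum>k=0..n. tree_coeff n k * y ^ k))
    \<and> (\<forall>n k. 1 \<le> k \<and> k \<le> n \<longrightarrow>
          (tree_coeff n k :: 'a) =
            (\<Sum>i=k..n. \<Sum>j=k..i.
               of_int (stirling1 j k) * (of_nat n ^ (n - i) * fact i / fact j)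
               * of_nat ((i - 1) choose (j - 1)) * of_nat ((n - 1) choose (i - 1))))
    \<and> (\<forall>n (y::'a). poly (tree_poly n) y = complete_bell n (\<lambda>r. y * tree_coeff r 1))
    \<and> (\<forall>r\<ge>1.
          (tree_coeff r 1 :: 'a) =
            (\<Sum>i=1..r. \<Sum>j=1..i.
               (-1) ^ (j - 1) * (of_nat r ^ (r - i) * fact i / of_nat j)
               * of_nat ((i - 1) choose (j - 1)) * of_nat ((r - 1) choose (i - 1))))"

  using poly_tree_poly_eq_sum tree_coeff_stirling1 poly_tree_poly_complete_bell tree_coeff_1
  by blast

end
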